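(* Let $G$ be a finite simple $3$-degenerate graph with maximum degree $\Delta$. Then $a'(G) \le \Delta + 5$.
   Context: A graph $G$ is $3$-degenerate if every subgraph of $G$ has a vertex of degree at most $3$. An acyclic edge coloring of $G$ is a proper edge coloring (adjacent edges receive distinct colors) with no bichromatic cycle, i.e., no cycle whose edges use exactly two colors. The acyclic chromatic index $a'(G)$ is the minimum number of colors in an acyclic edge coloring of $G$. *)

theory Defs
  imports Main
begin

text \<open>A finite simple graph is a finite vertex set \<open>V\<close> with a set \<open>E\<close> of two-element subsets of \<open>V\<close>.\<close>

definition simple_graph :: "'a set \<Rightarrow> 'a set set \<Rightarrow> bool" where
  "simple_graph V E \<longleftrightarrow> finite V \<and> (\<forall>e\<in>E. e \<subseteq> V \<and> card e = 2)"

definition degree :: "'a set set \<Rightarrow> 'a \<Rightarrow> nat" where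
  "degree E v = card {e \<in> E. v \<in> e}"

text \<open>The inserted \<open>0\<close> only matters for the graph without vertices.\<close>

definition max_degree :: "'a set \<Rightarrow> 'a set set \<Rightarrow> nat" where
  "max_degree V E = Max (insert 0 (degree E ` V))"

definition subgraph :: "'a set \<Rightarrow> 'a set set \<Rightarrow> 'a set \<Rightarrow> 'a set set \<Rightarrow> bool" where
  "subgraph V' E' V E \<longleftrightarrow> simple_graph V' E' \<and> V' \<subseteq> V \<and> E' \<subseteq> E"

definition degenerate :: "nat \<Rightarrow> 'a set \<Rightarrow> 'a set set \<Rightarrow> bool" where
  "degenerate k V E \<longleftrightarrow>
     (\<forall>V' E'. subgraph V' E' V E \<and> V' \<noteq> {} \<longrightarrow> (\<exists>v\<in>V'. degree E' v \<le> k))"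

definition proper_edge_coloring :: "'a set set \<Rightarrow> ('a set \<Rightarrow> nat) \<Rightarrow> bool" where
  "proper_edge_coloring E c \<longleftrightarrow>
     (\<forall>e\<in>E. \<forall>f\<in>E. e \<noteq> f \<and> e \<inter> f \<noteq> {} \<longrightarrow> c e \<noteq> c f)"

text \<open>A cycle is given by the list of its vertices in cyclic order, the first one not repeated at
  the end.\<close>

definition cycle_edges :: "'a list \<Rightarrow> 'a set set" where
  "cycle_edges vs = {{vs ! i, vs ! (Suc i mod length vs)} | i. i < length vs}"

definition is_cycle :: "'a set set \<Rightarrow> 'a list \<Rightarrow> bool" where
  "is_cycle E vs \<longleftrightarrow> 3 \<le> length vs \<and> distinct vs \<and> cycle_edges vs \<subseteq> E"

definition acyclic_edge_coloring :: "'a set set \<Rightarrow> ('a set \<Rightarrow> nat) \<Rightarrow> bool" where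
  "acyclic_edge_coloring E c \<longleftrightarrow>
     proper_edge_coloring E c \<and>
     \<not> (\<exists>vs. is_cycle E vs \<and> card (c ` cycle_edges vs) = 2)"

definition acyclic_chromatic_index :: "'a set set \<Rightarrow> nat" where
  "acyclic_chromatic_index E =
     (LEAST k. \<exists>c. acyclic_edge_coloring E c \<and> card (c ` E) = k)"

text \<open>The minimum is attained, as an injective coloring is acyclic.\<close>

lemma card_cycle_edges_ge_3:
  assumes "3 \<le> length vs" "distinct vs"
  shows "3 \<le> card (cycle_edges vs)"
proof -
  obtain a b d ws where vs: "vs = a # b # d # ws"
    using assms(1) by (auto simp: Suc_le_length_iff numeral_3_eq_3)
  have "finite (cycle_edges vs)"
    unfolding cycle_edges_def by simp
  have 1: "{a, b} \<in> cycle_edges vs"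
    unfolding cycle_edges_def using vs by (auto intro!: exI[of _ 0])
  have 2: "{b, d} \<in> cycle_edges vs"
    unfolding cycle_edges_def using vs by (auto intro!: exI[of _ 1])
  have 3: "{last vs, a} \<in> cycle_edges vs"
    unfolding cycle_edges_def mem_Collect_eq
    by (rule exI[of _ "length vs - 1"]) (simp add: vs last_conv_nth)
  have "last vs \<in> set (d # ws)"
    by (simp add: vs)
  with assms(2) have "last vs \<noteq> a" "last vs \<noteq> b"
    by (auto simp: vs)
  moreover have "a \<noteq> b" "a \<noteq> d" "b \<noteq> d"
    using assms(2) vs by auto
  ultimately have "card {{a, b}, {b, d}, {last vs, a}} = 3"
    by (auto simp: doubleton_eq_iff card_insert_if)
  then show ?thesis
    using card_mono[OF \<open>finite (cycle_edges vs)\<close>, of "{{a, b}, {b, d}, {last vs, a}}"] 1 2 3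
    by simp
qed

lemma acyclic_chromatic_index_attained:
  assumes "simple_graph V E"
  obtains c where "acyclic_edge_coloring E c" "card (c ` E) = acyclic_chromatic_index E"
proof -
  have "finite E"
    using assms unfolding simple_graph_def by (auto intro: finite_subset[of E "Pow V"])
  then obtain c :: "'a set \<Rightarrow> nat" where c: "inj_on c E"
    using finite_imp_inj_to_nat_seg by metis
  have "card (c ` cycle_edges vs) \<noteq> 2" if "is_cycle E vs" for vs
  proof -
    have "card (c ` cycle_edges vs) = card (cycle_edges vs)"
      using that c by (auto simp: is_cycle_def intro: card_image inj_on_subset)
    then show ?thesis
      using that card_cycle_edges_ge_3[of vs] by (auto simp: is_cycle_def)
  qed
  with c have "acyclic_edge_coloring E c"
    by (auto simp: acyclic_edge_coloring_def proper_edge_coloring_def inj_on_def)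
  then have "\<exists>k c. acyclic_edge_coloring E c \<and> card (c ` E) = k"
    by blast
  from LeastI_ex[OF this] show ?thesis
    using that unfolding acyclic_chromatic_index_def by blast
qed

end

theory Submission
  imports Defs
begin

text \<open>Induction on the number of edges. Some vertex \<open>v\<close> has at most three heavy neighbors (of degree
  at least 4) and a light neighbor \<open>x\<close> (of degree at most 3). Color \<open>G - vx\<close> with \<open>\<Delta> + 5\<close> colors, so
  that at least six colors are free at \<open>v\<close>. A free color \<open>d\<close> can fail on \<open>vx\<close> only because of
  a \<open>(d, \<gamma>)\<close>-path from \<open>v\<close> to \<open>x\<close>, and a color \<open>\<gamma>\<close> on an edge from \<open>v\<close> to a light neighbor spoils at
  most two \<open>d\<close>. If all free colors fail, then some edge \<open>xy\<close> has the color of an edge from \<open>v\<close> to a heavy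
  neighbor. Take a color \<open>\<theta>\<close> missing at \<open>y\<close> and \<open>x\<close> and not used between \<open>v\<close> and its heavy neighbors;
  there are three of them. Recoloring \<open>xy\<close> with \<open>\<theta>\<close> reduces the number of heavy colors at \<open>x\<close>, or else it
  is prevented by a two-colored path from \<open>x\<close> to \<open>y\<close>; as this path cannot end at \<open>v\<close> as well, \<open>\<theta>\<close>
  then fits on \<open>vx\<close> unless it already occurs at \<open>v\<close>, on an edge \<open>vu\<close> with \<open>u\<close> light. If \<open>vu\<close> could be
  recolored with a free color, the previous case would apply. So \<open>x\<close> and the three vertices
  \<open>u\<close> are all blocked for all free colors. For each heavy color \<open>\<gamma>\<close> and free \<open>d\<close>, the \<open>(d, \<gamma>)\<close>-path
  from \<open>v\<close> has only one other end, and counting shows that four blocked vertices are too many.\<close>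

section \<open>Connectivity, forests and two-colored subgraphs\<close>

definition conn :: "'a set set \<Rightarrow> 'a \<Rightarrow> 'a \<Rightarrow> bool" where
  "conn F p q \<longleftrightarrow> (p, q) \<in> {(a, b). {a, b} \<in> F}\<^sup>*"

text \<open>Every edge is a bridge. This form avoids cycles as lists and is easy to maintain while
  edges are inserted one at a time.\<close>

definition forest :: "'a set set \<Rightarrow> bool" where
  "forest F \<longleftrightarrow> (\<forall>p q. {p, q} \<in> F \<longrightarrow> \<not> conn (F - {{p, q}}) p q)"

definition two_colored :: "'a set set \<Rightarrow> ('a set \<Rightarrow> nat) \<Rightarrow> nat \<Rightarrow> nat \<Rightarrow> 'a set set" where
  "two_colored E c \<alpha> \<beta> = {e \<in> E. c e = \<alpha> \<or> c e = \<beta>}"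

text \<open>The working notion of an acyclic coloring; \<open>forest_coloring_acyclic\<close>
  translates it back to cycles. The case \<open>\<alpha> = \<beta>\<close> is harmless, as in a
  simple graph a proper color class is a matching.\<close>

definition forest_coloring :: "'a set set \<Rightarrow> ('a set \<Rightarrow> nat) \<Rightarrow> bool" where
  "forest_coloring E c \<longleftrightarrow>
     proper_edge_coloring E c \<and> (\<forall>\<alpha> \<beta>. forest (two_colored E c \<alpha> \<beta>))"

definition colors_at :: "'a set set \<Rightarrow> ('a set \<Rightarrow> nat) \<Rightarrow> 'a \<Rightarrow> nat set" where
  "colors_at E c v = c ` {e \<in> E. v \<in> e}"

lemma conn_refl [simp]: "conn F p p"
  by (simp add: conn_def)

lemma conn_edge: "{p, q} \<in> F \<Longrightarrow> conn F p q"
  by (auto simp: conn_def)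

lemma conn_trans: "conn F p q \<Longrightarrow> conn F q r \<Longrightarrow> conn F p r"
  by (auto simp: conn_def)

lemma conn_sym: "conn F p q \<Longrightarrow> conn F q p"
proof -
  have "sym {(a, b). {a, b} \<in> F}"
    by (auto simp: sym_def insert_commute)
  then show "conn F p q \<Longrightarrow> conn F q p"
    unfolding conn_def by (meson sym_rtrancl symD)
qed

lemma conn_mono: "conn F p q \<Longrightarrow> F \<subseteq> F' \<Longrightarrow> conn F' p q"
  unfolding conn_def by (erule rtrancl_mono[THEN subsetD, rotated]) auto

lemma conn_induct [consumes 1, case_names refl step]:
  assumes "conn F p q" "P p" "\<And>a b. conn F p a \<Longrightarrow> {a, b} \<in> F \<Longrightarrow> P a \<Longrightarrow> P b"
  shows "P q"
  using assms unfolding conn_def by (induction rule: rtrancl_induct) auto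

text \<open>A path can be shortened to use the new edge at most once; the cases are no use and the
  two directions of traversal.\<close>

lemma conn_insertD:
  assumes "conn (insert {v, x} F) p q"
  shows "conn F p q \<or> (conn F p v \<and> conn F x q) \<or> (conn F p x \<and> conn F v q)"
  using assms
proof (induction rule: conn_induct)
  case refl
  then show ?case by simp
next
  case (step a b)
  show ?case
  proof (cases "{a, b} \<in> F")
    case True
    then show ?thesis using step conn_trans conn_edge by metis
  next
    case False
    with step have "(a = v \<and> b = x) \<or> (a = x \<and> b = v)"
      by (auto simp: doubleton_eq_iff)
    then show ?thesis using step by auto
  qed
qed

lemma forest_mono: "forest F \<Longrightarrow> F' \<subseteq> F \<Longrightarrow> forest F'"
  unfolding forest_def
proof (intro allI impI)
  fix p q
  assume "\<forall>p q. {p, q} \<in> F \<longrightarrow> \<not> conn (F - {{p, q}}) p q" "F' \<subseteq> F" "{p, q} \<in> F'"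
  then show "\<not> conn (F' - {{p, q}}) p q"
    using conn_mono[of "F' - {{p, q}}" p q "F - {{p, q}}"] by blast
qed

text \<open>If the ends of an old edge were joined without it, the path would run through the new
  edge and, together with the old edge, would join \<open>v\<close> to \<open>x\<close> inside
  \<open>F\<close>.\<close>

lemma forest_insert:
  assumes F: "forest F" and n: "\<not> conn F v x"
  shows "forest (insert {v, x} F)"
  unfolding forest_def
proof (intro allI impI)
  fix p q
  assume pq: "{p, q} \<in> insert {v, x} F"
  show "\<not> conn (insert {v, x} F - {{p, q}}) p q"
  proof (cases "{p, q} = {v, x}")
    case True
    then have "conn (insert {v, x} F - {{p, q}}) p q \<Longrightarrow> conn F p q"
      by (elim conn_mono) auto
    with True n conn_sym show ?thesis by (metis doubleton_eq_iff)
  next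
    case False
    with pq have e: "{p, q} \<in> F" by simp
    show ?thesis
    proof
      assume "conn (insert {v, x} F - {{p, q}}) p q"
      then have "conn (insert {v, x} (F - {{p, q}})) p q"
        by (rule conn_mono) auto
      from conn_insertD[OF this] show False
      proof (elim disjE conjE)
        assume "conn (F - {{p, q}}) p q"
        then show False using F e by (auto simp: forest_def)
      next
        assume "conn (F - {{p, q}}) p v" "conn (F - {{p, q}}) x q"
        then have "conn F p v" "conn F x q" by (auto elim: conn_mono)
        then show False using n e conn_edge conn_trans conn_sym by metis
      next
        assume "conn (F - {{p, q}}) p x" "conn (F - {{p, q}}) v q"
        then have "conn F p x" "conn F v q" by (auto elim: conn_mono)
        then show False using n e conn_edge conn_trans conn_sym by metis
      qed
    qed
  qed
qed

lemma colors_atI: "e \<in> E \<Longrightarrow> v \<in> e \<Longrightarrow> c e \<in> colors_at E c v"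
  by (auto simp: colors_at_def)

lemma finite_colors_at: "finite E \<Longrightarrow> finite (colors_at E c v)"
  by (simp add: colors_at_def)

lemma card_colors_at: "finite E \<Longrightarrow> card (colors_at E c v) \<le> degree E v"
  by (simp add: colors_at_def degree_def card_image_le)

lemma forest_coloring_mono:
  assumes "forest_coloring E c" "E' \<subseteq> E"
  shows "forest_coloring E' c"
proof -
  have "two_colored E' c \<alpha> \<beta> \<subseteq> two_colored E c \<alpha> \<beta>" for \<alpha> \<beta>
    using assms(2) by (auto simp: two_colored_def)
  then have "forest (two_colored E' c \<alpha> \<beta>)" for \<alpha> \<beta>
    using assms(1) forest_mono[of "two_colored E c \<alpha> \<beta>"] by (simp add: forest_coloring_def)
  moreover have "proper_edge_coloring E' c"
    using assms unfolding forest_coloring_def proper_edge_coloring_def by blast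
  ultimately show ?thesis by (simp add: forest_coloring_def)
qed

text \<open>Only color pairs containing \<open>d\<close> acquire an edge, so apart from properness
  the sole obstacle is a two-colored path between \<open>v\<close> and \<open>x\<close> that uses
  \<open>d\<close>. Recoloring an edge is the same step after deleting it.\<close>

lemma forest_coloring_insert:
  assumes c: "forest_coloring E c" and e: "{v, x} \<notin> E"
    and v: "d \<notin> colors_at E c v" and x: "d \<notin> colors_at E c x"
    and n: "\<And>\<gamma>. \<not> conn (two_colored E c d \<gamma>) v x"
  shows "forest_coloring (insert {v, x} E) (c({v, x} := d))" (is "forest_coloring ?E ?c")
proof -
  have new: "c f \<noteq> d" if "f \<in> E" "f \<inter> {v, x} \<noteq> {}" for f
    using that v x by (auto simp: colors_at_def)
  have old: "c f \<noteq> c g" if "f \<in> E" "g \<in> E" "f \<noteq> g" "f \<inter> g \<noteq> {}" for f g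
    using that c unfolding forest_coloring_def proper_edge_coloring_def by blast
  have "proper_edge_coloring ?E ?c"
    unfolding proper_edge_coloring_def
  proof (intro ballI impI)
    fix f g
    assume fg: "f \<in> ?E" "g \<in> ?E" "f \<noteq> g \<and> f \<inter> g \<noteq> {}"
    show "?c f \<noteq> ?c g"
    proof (cases "f = {v, x}")
      case True
      with fg have "g \<in> E" "g \<noteq> {v, x}" "g \<inter> {v, x} \<noteq> {}" by auto
      with True new show ?thesis by (metis fun_upd_apply)
    next
      case f: False
      show ?thesis
      proof (cases "g = {v, x}")
        case True
        with fg have "f \<in> E" "f \<inter> {v, x} \<noteq> {}" by auto
        with True f new show ?thesis by (metis fun_upd_apply)
      next
        case False
        with f fg have "f \<in> E" "g \<in> E" by auto
        with old fg f False show ?thesis by simp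
      qed
    qed
  qed
  moreover have "forest (two_colored ?E ?c \<alpha> \<beta>)" for \<alpha> \<beta>
  proof (cases "d = \<alpha> \<or> d = \<beta>")
    case True
    then have "two_colored E c d (if d = \<alpha> then \<beta> else \<alpha>) = two_colored E c \<alpha> \<beta>"
      by (auto simp: two_colored_def)
    then obtain \<gamma> where "two_colored E c d \<gamma> = two_colored E c \<alpha> \<beta>"
      by blast
    moreover have "two_colored ?E ?c \<alpha> \<beta> = insert {v, x} (two_colored E c \<alpha> \<beta>)"
      using True e by (auto simp: two_colored_def)
    ultimately show ?thesis
      using forest_insert c n[of \<gamma>] by (metis forest_coloring_def)
  next
    case False
    then have "two_colored ?E ?c \<alpha> \<beta> = two_colored E c \<alpha> \<beta>"
      using e by (auto simp: two_colored_def)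
    then show ?thesis using c by (simp add: forest_coloring_def)
  qed
  ultimately show ?thesis by (simp add: forest_coloring_def)
qed

text \<open>The rest of the cycle joins the ends of the closing edge, so that edge is not a
  bridge.\<close>

lemma cycle_imp_not_forest:
  assumes vs: "3 \<le> length vs" "distinct vs" and F: "cycle_edges vs \<subseteq> F"
  shows "\<not> forest F"
proof
  assume "forest F"
  let ?n = "length vs"
  let ?e = "{vs ! 0, vs ! (?n - 1)}"
  have "Suc (?n - 1) = ?n" using vs by linarith
  then have "Suc (?n - 1) mod ?n = 0" by simp
  then have "{vs ! (?n - 1), vs ! 0} \<in> cycle_edges vs"
    unfolding cycle_edges_def mem_Collect_eq using vs
    by (intro exI[of _ "?n - 1"]) auto
  then have e: "?e \<in> F" using F by (auto simp: insert_commute)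
  have "conn (F - {?e}) (vs ! 0) (vs ! i)" if "i < ?n" for i
    using that
  proof (induction i)
    case 0
    then show ?case by simp
  next
    case (Suc i)
    then have "{vs ! i, vs ! (Suc i mod length vs)} \<in> cycle_edges vs"
      unfolding cycle_edges_def mem_Collect_eq by (intro exI[of _ i]) simp
    then have "{vs ! i, vs ! Suc i} \<in> F"
      using F Suc.prems by auto
    \<comment> \<open>Equality would force \<open>i = 0\<close> and \<open>Suc i = ?n - 1\<close>,
      hence a cycle of length two.\<close>
    moreover have "{vs ! i, vs ! Suc i} \<noteq> ?e"
    proof -
      have "vs ! i \<noteq> vs ! (?n - 1)" "vs ! Suc i \<noteq> vs ! 0"
        using Suc.prems vs nth_eq_iff_index_eq[of vs i "?n - 1"] nth_eq_iff_index_eq[of vs "Suc i" 0]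
        by fastforce+
      moreover have "vs ! i \<noteq> vs ! 0 \<or> vs ! Suc i \<noteq> vs ! (?n - 1)"
      proof (cases "i = 0")
        case True
        then show ?thesis
          using vs nth_eq_iff_index_eq[of vs 1 "?n - 1"] by simp
      next
        case False
        then show ?thesis
          using Suc.prems vs(2) nth_eq_iff_index_eq[of vs i 0] by (cases vs) auto
      qed
      ultimately show ?thesis by (simp add: doubleton_eq_iff)
    qed
    ultimately have "conn (F - {?e}) (vs ! i) (vs ! Suc i)"
      by (intro conn_edge) auto
    with Suc.IH[OF Suc_lessD[OF Suc.prems]] show ?case by (rule conn_trans)
  qed
  then have "conn (F - {?e}) (vs ! 0) (vs ! (?n - 1))" using vs by simp
  with e \<open>forest F\<close> show False by (auto simp: forest_def)
qed

lemma forest_coloring_acyclic: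
  assumes "forest_coloring E c"
  shows "acyclic_edge_coloring E c"
  unfolding acyclic_edge_coloring_def
proof (intro conjI notI)
  show "proper_edge_coloring E c" using assms by (simp add: forest_coloring_def)
next
  assume "\<exists>vs. is_cycle E vs \<and> card (c ` cycle_edges vs) = 2"
  then obtain vs \<alpha> \<beta> where vs: "is_cycle E vs" and ab: "c ` cycle_edges vs = {\<alpha>, \<beta>}"
    by (auto simp: card_2_iff)
  then have "cycle_edges vs \<subseteq> two_colored E c \<alpha> \<beta>"
    unfolding two_colored_def is_cycle_def by blast
  with cycle_imp_not_forest[of vs] vs assms show False
    by (auto simp: is_cycle_def forest_coloring_def)
qed

section \<open>Two-colored paths as deterministic walks\<close>

text \<open>The flag of a state records the color of the edge to leave by. A walk from a vertex missing
  \<open>d\<close> is deterministic, which makes the other end of its two-colored path unique.\<close>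

definition walk_step :: "'a set set \<Rightarrow> ('a set \<Rightarrow> nat) \<Rightarrow> nat \<Rightarrow> nat \<Rightarrow> (('a \<times> bool) \<times> ('a \<times> bool)) set" where
  "walk_step E c d \<gamma> =
     {((p, b), (q, b')). {p, q} \<in> E \<and> c {p, q} = (if b then d else \<gamma>) \<and> b' = (\<not> b)}"

lemma same_color_neighbor:
  assumes "proper_edge_coloring E c" "{p, q} \<in> E" "{p, q'} \<in> E" "c {p, q} = c {p, q'}"
  shows "q = q'"
proof -
  have "{p, q} \<inter> {p, q'} \<noteq> {}" by simp
  with assms have "{p, q} = {p, q'}"
    unfolding proper_edge_coloring_def by metis
  then show ?thesis by (auto simp: doubleton_eq_iff)
qed

lemma single_valued_walk_step:
  "proper_edge_coloring E c \<Longrightarrow> single_valued (walk_step E c d \<gamma>)"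
  by (auto simp: single_valued_def walk_step_def dest: same_color_neighbor)

text \<open>Along a two-colored edge the walk either goes on or, if it arrived by this edge, has
  already visited the other end. At the start only the first can happen, since \<open>d\<close> is
  missing at \<open>v\<close>.\<close>

lemma conn_imp_walk:
  assumes c: "proper_edge_coloring E c" and v: "d \<notin> colors_at E c v"
    and "conn (two_colored E c d \<gamma>) v u"
  shows "\<exists>b. ((v, False), (u, b)) \<in> (walk_step E c d \<gamma>)\<^sup>*"
  using assms(3)
proof (induction rule: conn_induct)
  case refl
  then show ?case by blast
next
  case (step p q)
  then obtain b where b: "((v, False), (p, b)) \<in> (walk_step E c d \<gamma>)\<^sup>*" by blast
  have pq: "{p, q} \<in> E" "c {p, q} = d \<or> c {p, q} = \<gamma>"
    using step by (auto simp: two_colored_def)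
  show ?case
  proof (cases "c {p, q} = (if b then d else \<gamma>)")
    case True
    then have "((p, b), (q, \<not> b)) \<in> walk_step E c d \<gamma>"
      using pq by (simp add: walk_step_def)
    with b show ?thesis by (meson rtrancl.rtrancl_into_rtrancl)
  next
    case False
    with pq have opposite: "c {p, q} = (if b then \<gamma> else d)" by auto
    have "(p, b) \<noteq> (v, False)"
    proof
      assume "(p, b) = (v, False)"
      then have "d \<in> colors_at E c v"
        using opposite pq(1) colors_atI[of "{p, q}" E v c] by auto
      with v show False by simp
    qed
    with b obtain p' b' where p': "((v, False), (p', b')) \<in> (walk_step E c d \<gamma>)\<^sup>*"
      "((p', b'), (p, b)) \<in> walk_step E c d \<gamma>"
      by (auto elim: rtranclE)
    then have "{p, p'} \<in> E" "c {p, p'} = c {p, q}"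
      using opposite by (auto simp: walk_step_def insert_commute split: if_splits)
    then have "p' = q" using same_color_neighbor[OF c] pq(1) by metis
    with p'(1) show ?thesis by blast
  qed
qed

text \<open>As \<open>d\<close> is missing at \<open>u\<close>, the walk can only arrive there by
  \<open>\<gamma>\<close>, and so it would have to leave by \<open>d\<close>.\<close>

lemma walk_to_endpoint:
  assumes c: "proper_edge_coloring E c" and v: "d \<notin> colors_at E c v"
    and u: "d \<notin> colors_at E c u" "u \<noteq> v"
    and con: "conn (two_colored E c d \<gamma>) v u"
  shows "((v, False), (u, True)) \<in> (walk_step E c d \<gamma>)\<^sup>*" "\<gamma> \<in> colors_at E c u"
proof -
  obtain b where b: "((v, False), (u, b)) \<in> (walk_step E c d \<gamma>)\<^sup>*"
    using conn_imp_walk[OF c v con] by blast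
  then have "((v, False), (u, b)) \<in> (walk_step E c d \<gamma>)\<^sup>+"
    using \<open>u \<noteq> v\<close> by (simp add: rtrancl_eq_or_trancl)
  then obtain p b' where "((p, b'), (u, b)) \<in> walk_step E c d \<gamma>"
    using tranclD2 by (metis surj_pair)
  then have p: "{p, u} \<in> E" "c {p, u} = (if b then \<gamma> else d)"
    by (auto simp: walk_step_def)
  then have "c {p, u} \<in> colors_at E c u" by (auto intro: colors_atI)
  with p u have "b" "c {p, u} = \<gamma>" by (auto split: if_splits)
  with b \<open>c {p, u} \<in> colors_at E c u\<close>
  show "((v, False), (u, True)) \<in> (walk_step E c d \<gamma>)\<^sup>*" "\<gamma> \<in> colors_at E c u" by auto
qed

text \<open>The walk leaves \<open>v\<close> by \<open>\<gamma>\<close>, and unless it is then at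
  \<open>u\<close>, its second edge has color \<open>d\<close>.\<close>

lemma conn_first_edge:
  assumes c: "proper_edge_coloring E c" and v: "d \<notin> colors_at E c v"
    and u: "d \<notin> colors_at E c u" "u \<noteq> v"
    and con: "conn (two_colored E c d \<gamma>) v u"
  obtains t where "{v, t} \<in> E" "c {v, t} = \<gamma>" "t = u \<or> d \<in> colors_at E c t"
proof -
  have "((v, False), (u, True)) \<in> (walk_step E c d \<gamma>)\<^sup>*"
    using walk_to_endpoint[OF assms] by simp
  then have "((v, False), (u, True)) \<in> (walk_step E c d \<gamma>)\<^sup>+"
    by (simp add: rtrancl_eq_or_trancl)
  then obtain t b where "((v, False), (t, b)) \<in> walk_step E c d \<gamma>"
    "((t, b), (u, True)) \<in> (walk_step E c d \<gamma>)\<^sup>*"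
    using tranclD by (metis surj_pair)
  then have t: "{v, t} \<in> E" "c {v, t} = \<gamma>"
    "((t, True), (u, True)) \<in> (walk_step E c d \<gamma>)\<^sup>*"
    by (auto simp: walk_step_def)
  have "t = u \<or> d \<in> colors_at E c t"
    using t(3)
  proof (cases rule: converse_rtranclE)
    case (step y)
    then obtain q where "{t, q} \<in> E" "c {t, q} = d" by (auto simp: walk_step_def)
    then show ?thesis using colors_atI[of "{t, q}" E t c] by auto
  qed simp
  with t that show ?thesis by blast
qed

text \<open>Both ends lie on the same deterministic walk, so one is reached from the other; but the
  walk stops where \<open>d\<close> is missing.\<close>

lemma unique_other_endpoint:
  assumes c: "proper_edge_coloring E c" and v: "d \<notin> colors_at E c v"
    and u: "d \<notin> colors_at E c u" "u \<noteq> v" "conn (two_colored E c d \<gamma>) v u"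
    and w: "d \<notin> colors_at E c w" "w \<noteq> v" "conn (two_colored E c d \<gamma>) v w"
  shows "u = w"
proof -
  let ?S = "walk_step E c d \<gamma>"
  have stuck: "q = (p, True)" if "((p, True), q) \<in> ?S\<^sup>*" "d \<notin> colors_at E c p" for p q
    using that(1)
  proof (cases rule: converse_rtranclE)
    case (step y)
    then obtain t where "{p, t} \<in> E" "c {p, t} = d" by (auto simp: walk_step_def)
    then show ?thesis using that(2) colors_atI[of "{p, t}" E p c] by auto
  qed simp
  have "((u, True), (w, True)) \<in> ?S\<^sup>* \<or> ((w, True), (u, True)) \<in> ?S\<^sup>*"
    using single_valued_confluent[OF single_valued_walk_step[OF c]]
      walk_to_endpoint(1)[OF c v u] walk_to_endpoint(1)[OF c v w] by blast
  then show ?thesis using stuck u(1) w(1) by blast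
qed

section \<open>The counting argument for four blocked vertices\<close>

text \<open>Here \<open>L\<close> stands for the free colors, \<open>C\<close> for the heavy colors,
  \<open>W u\<close> for the colors at \<open>u\<close> other than on the edge to \<open>v\<close>,
  and \<open>Q u \<gamma>\<close> for the free colors that \<open>\<gamma>\<close> spoils at
  \<open>u\<close>. A heavy color spoils each free color at one vertex at most, so three heavy
  colors do not suffice for four vertices.\<close>

lemma four_blocked_impossible:
  fixes Q :: "'u \<Rightarrow> 'g \<Rightarrow> 'd set" and W :: "'u \<Rightarrow> 'g set"
  assumes L: "finite L" "6 \<le> card L" and C: "finite C" "card C \<le> 3" and U: "4 \<le> card U"
    and W: "\<And>u. u \<in> U \<Longrightarrow> finite (W u)" "\<And>u. u \<in> U \<Longrightarrow> card (W u) \<le> 2"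
    and cover: "\<And>u. u \<in> U \<Longrightarrow> L \<subseteq> (\<Union>\<gamma>\<in>W u. Q u \<gamma>)"
    and sub: "\<And>u \<gamma>. u \<in> U \<Longrightarrow> Q u \<gamma> \<subseteq> L"
    and small: "\<And>u \<gamma>. u \<in> U \<Longrightarrow> \<gamma> \<in> W u \<Longrightarrow> \<gamma> \<notin> C \<Longrightarrow> card (Q u \<gamma>) \<le> 2"
    and disj: "\<And>u u' \<gamma>. u \<in> U \<Longrightarrow> u' \<in> U \<Longrightarrow> u \<noteq> u' \<Longrightarrow> \<gamma> \<in> C \<Longrightarrow> Q u \<gamma> \<inter> Q u' \<gamma> = {}"
  shows False
proof -
  let ?l = "card L"
  obtain U' where U': "U' \<subseteq> U" "card U' = 4" "finite U'"
    using obtain_subset_with_card_n[OF U] by metis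
  have finQ: "finite (Q u \<gamma>)" if "u \<in> U" for u \<gamma>
    using sub[OF that] L(1) finite_subset by blast
  have pair: "card (Q u \<gamma>) + card (Q u' \<gamma>) \<le> ?l"
    if "u \<in> U" "u' \<in> U" "u \<noteq> u'" "\<gamma> \<in> C" for u u' \<gamma>
  proof -
    have "card (Q u \<gamma> \<union> Q u' \<gamma>) \<le> ?l"
      using that sub L(1) by (meson Un_least card_mono)
    then show ?thesis
      using card_Un_disjoint[of "Q u \<gamma>" "Q u' \<gamma>"] disj[OF that] finQ that by simp
  qed
  have W_two: "\<exists>\<gamma>1 \<gamma>2. W u \<subseteq> {\<gamma>1, \<gamma>2} \<and> \<gamma>1 \<in> W u \<and> \<gamma>2 \<in> W u \<and> ?l \<le> card (Q u \<gamma>1) + card (Q u \<gamma>2)"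
    if u: "u \<in> U" for u
  proof -
    have "W u \<noteq> {}" using cover[OF u] L by auto
    moreover have "card (W u) = 0 \<or> card (W u) = 1 \<or> card (W u) = 2" using W(2)[OF u] by linarith
    ultimately obtain \<gamma>1 \<gamma>2 where g: "W u = {\<gamma>1, \<gamma>2}"
      using W(1)[OF u] by (metis card_0_eq card_1_singletonE card_2_iff insert_absorb2)
    then have "?l \<le> card (Q u \<gamma>1 \<union> Q u \<gamma>2)"
      using cover[OF u] finQ[OF u] by (intro card_mono) auto
    also have "\<dots> \<le> card (Q u \<gamma>1) + card (Q u \<gamma>2)" by (rule card_Un_le)
    finally show ?thesis using g by blast
  qed
  \<comment> \<open>The vertices at which a single heavy color spoils all but at most two free
    colors. At the others two distinct heavy colors must share the work, because a color outside
    \<open>C\<close> spoils at most two.\<close>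
  define S where "S = {u \<in> U'. \<exists>\<gamma>\<in>C. ?l - 2 \<le> card (Q u \<gamma>)}"
  have nonS: "\<exists>\<gamma>1\<in>C. \<exists>\<gamma>2\<in>C. \<gamma>1 \<noteq> \<gamma>2 \<and> ?l \<le> card (Q u \<gamma>1) + card (Q u \<gamma>2)" if u: "u \<in> U'" "u \<notin> S" for u
  proof -
    have uU: "u \<in> U" using u U' by auto
    obtain \<gamma>1 \<gamma>2 where g: "\<gamma>1 \<in> W u" "\<gamma>2 \<in> W u" "?l \<le> card (Q u \<gamma>1) + card (Q u \<gamma>2)"
      "W u \<subseteq> {\<gamma>1, \<gamma>2}"
      using W_two[OF uU] by blast
    have lt: "card (Q u \<gamma>) < ?l - 2" if "\<gamma> \<in> C" for \<gamma>
      using that u by (force simp: S_def)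
    have "\<gamma>1 \<in> C" "\<gamma>2 \<in> C"
      using g small[OF uU, of \<gamma>1] small[OF uU, of \<gamma>2] lt[of \<gamma>1] lt[of \<gamma>2] L by force+
    moreover have "\<gamma>1 \<noteq> \<gamma>2"
    proof
      assume "\<gamma>1 = \<gamma>2"
      then have "L \<subseteq> Q u \<gamma>1" using cover[OF uU] g by auto
      then have "?l \<le> card (Q u \<gamma>1)" using finQ[OF uU] by (simp add: card_mono)
      with lt[OF \<open>\<gamma>1 \<in> C\<close>] show False by simp
    qed
    ultimately show ?thesis using g by blast
  qed
  have "\<forall>u\<in>S. \<exists>\<gamma>. \<gamma> \<in> C \<and> ?l - 2 \<le> card (Q u \<gamma>)"
    by (auto simp: S_def)
  then obtain f where f: "\<And>u. u \<in> S \<Longrightarrow> f u \<in> C \<and> ?l - 2 \<le> card (Q u (f u))"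
    by metis
  have SU: "S \<subseteq> U'" "finite S" using U' by (auto simp: S_def)
  \<comment> \<open>Two vertices with a common color would give
    \<open>2 * (?l - 2) \<le> ?l\<close>, against \<open>6 \<le> ?l\<close>.\<close>
  have "inj_on f S"
  proof (rule inj_onI, rule ccontr)
    fix u u'
    assume a: "u \<in> S" "u' \<in> S" "f u = f u'" "u \<noteq> u'"
    then have "card (Q u (f u)) + card (Q u' (f u)) \<le> ?l"
      using pair[of u u' "f u"] f[of u] SU U' by blast
    then show False using f[of u] f[of u'] a L by auto
  qed
  then have cS: "card (f ` S) = card S" by (rule card_image)
  have fS: "f ` S \<subseteq> C" using f by blast
  then have "card S \<le> 3" using cS C card_mono le_trans by metis
  then have "card (U' - S) = 4 - card S" "card S \<le> 3" using SU U' by (auto simp: card_Diff_subset)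
  show False
  proof (cases "card S = 3")
    case True
    then have fC: "f ` S = C" using C fS cS by (metis card_seteq)
    have "U' - S \<noteq> {}" using \<open>card (U' - S) = _\<close> True by force
    then obtain u where u: "u \<in> U'" "u \<notin> S" by blast
    \<comment> \<open>Each heavy color is nearly used up by its vertex in \<open>S\<close>, so at
      the fourth vertex two of them spoil at most four of the free colors.\<close>
    have "card (Q u \<gamma>) \<le> 2" if \<gamma>: "\<gamma> \<in> C" for \<gamma>
    proof -
      obtain s where s: "s \<in> S" "\<gamma> = f s" using fC \<gamma> by blast
      then have "card (Q u \<gamma>) + card (Q s \<gamma>) \<le> ?l"
        using pair[of u s \<gamma>] u U' SU \<gamma> by blast
      moreover have "?l - 2 \<le> card (Q s \<gamma>)" using s f by blast
      ultimately show ?thesis by linarith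
    qed
    moreover obtain \<gamma>1 \<gamma>2 where "\<gamma>1 \<in> C" "\<gamma>2 \<in> C" "?l \<le> card (Q u \<gamma>1) + card (Q u \<gamma>2)"
      using nonS[OF u] by blast
    ultimately have "?l \<le> 2 + 2" by (meson add_mono le_trans)
    then show False using L by linarith
  next
    case False
    with \<open>card S \<le> 3\<close> have s2: "card S \<le> 2" by simp
    have tot: "(\<Sum>\<gamma>\<in>C. card (Q u \<gamma>)) \<ge> (if u \<in> S then ?l - 2 else ?l)" if u: "u \<in> U'" for u
    proof (cases "u \<in> S")
      case True
      then show ?thesis using f[OF True] member_le_sum[of "f u" C "\<lambda>\<gamma>. card (Q u \<gamma>)"] C by auto
    next
      case False
      then obtain \<gamma>1 \<gamma>2 where g: "\<gamma>1 \<in> C" "\<gamma>2 \<in> C" "\<gamma>1 \<noteq> \<gamma>2" "?l \<le> card (Q u \<gamma>1) + card (Q u \<gamma>2)"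
        using nonS[OF u] by blast
      have "(\<Sum>\<gamma>\<in>{\<gamma>1, \<gamma>2}. card (Q u \<gamma>)) \<le> (\<Sum>\<gamma>\<in>C. card (Q u \<gamma>))"
        using g C by (intro sum_mono2) auto
      with g False show ?thesis by simp
    qed
    \<comment> \<open>Double counting: the four vertices require \<open>4 * ?l - 2 * card S\<close>,
      the heavy colors supply at most \<open>3 * ?l\<close>, and
      \<open>?l \<le> 2 * card S \<le> 4\<close> is absurd.\<close>
    have "4 * ?l - 2 * card S \<le> (\<Sum>u\<in>U'. if u \<in> S then ?l - 2 else ?l)"
    proof -
      have "(\<Sum>u\<in>U'. if u \<in> S then ?l - 2 else ?l) = card S * (?l - 2) + card (U' - S) * ?l"
        using SU U' by (simp add: sum.If_cases Int_absorb1 Diff_eq)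
      also have "\<dots> = 4 * ?l - 2 * card S"
      proof -
        have "card S = 0 \<or> card S = 1 \<or> card S = 2" using s2 by linarith
        then show ?thesis using \<open>card (U' - S) = _\<close> L by auto
      qed
      finally show ?thesis by simp
    qed
    also have "\<dots> \<le> (\<Sum>u\<in>U'. \<Sum>\<gamma>\<in>C. card (Q u \<gamma>))"
      by (rule sum_mono) (use tot in auto)
    also have "\<dots> = (\<Sum>\<gamma>\<in>C. \<Sum>u\<in>U'. card (Q u \<gamma>))" by (rule sum.swap)
    also have "\<dots> \<le> (\<Sum>\<gamma>\<in>C. ?l)"
    proof (rule sum_mono)
      fix \<gamma> assume \<gamma>: "\<gamma> \<in> C"
      have "(\<Sum>u\<in>U'. card (Q u \<gamma>)) = card (\<Union>u\<in>U'. Q u \<gamma>)"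
        using U' finQ disj \<gamma> by (subst card_UN_disjoint) (auto, blast)
      also have "\<dots> \<le> ?l" using sub U' L by (intro card_mono) blast+
      finally show "(\<Sum>u\<in>U'. card (Q u \<gamma>)) \<le> ?l" .
    qed
    also have "\<dots> \<le> 3 * ?l" using C by simp
    finally show False using s2 L by linarith
  qed
qed

section \<open>Extending a coloring to a missing edge\<close>

text \<open>\<open>E\<close> is the graph after deletion of \<open>{v, x}\<close>, and
  \<open>D\<close> bounds the degrees before it; hence the strict bound at \<open>v\<close> and the
  bound 2 at the light vertex \<open>x\<close>.\<close>

locale missing_edge =
  fixes E :: "'a set set" and v x :: 'a and D :: nat
  assumes finite_E: "finite E"
    and edge_card: "e \<in> E \<Longrightarrow> card e = 2"
    and v_neq_x: "v \<noteq> x"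
    and missing: "{v, x} \<notin> E"
    and degree_le: "degree E u \<le> D"
    and degree_v: "degree E v < D"
    and degree_x: "degree E x \<le> 2"
    and heavy: "card {w. {v, w} \<in> E \<and> 3 < degree E w} \<le> 3"
begin

definition heavy_colors :: "('a set \<Rightarrow> nat) \<Rightarrow> nat set" where
  "heavy_colors c = (\<lambda>w. c {v, w}) ` {w. {v, w} \<in> E \<and> 3 < degree E w}"

definition free :: "('a set \<Rightarrow> nat) \<Rightarrow> nat set" where
  "free c = {..<D + 5} - colors_at E c v"

text \<open>\<open>x\<close> is included although its edge is missing, so that it can be counted
  along with the neighbors whose edges may be recolored.\<close>

definition light :: "'a \<Rightarrow> bool" where
  "light u \<longleftrightarrow> u = x \<or> {v, u} \<in> E \<and> degree E u \<le> 3"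

text \<open>For \<open>u = x\<close> this concerns extending the coloring, for a neighbor
  \<open>u\<close> of \<open>v\<close> recoloring an existing edge, where the \<open>insert\<close>
  has no effect.\<close>

definition blocked :: "('a set \<Rightarrow> nat) \<Rightarrow> 'a \<Rightarrow> bool" where
  "blocked c u \<longleftrightarrow> (\<forall>d\<in>free c. \<not> forest_coloring (insert {v, u} E) (c({v, u} := d)))"

definition other_colors :: "('a set \<Rightarrow> nat) \<Rightarrow> 'a \<Rightarrow> nat set" where
  "other_colors c u = colors_at (E - {{v, u}}) c u"

text \<open>The case \<open>d = \<gamma>\<close> covers the free colors that already occur at \<open>u\<close>.\<close>

definition blocks :: "('a set \<Rightarrow> nat) \<Rightarrow> 'a \<Rightarrow> nat \<Rightarrow> nat set" where
  "blocks c u \<gamma> =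
     {d \<in> free c. d = \<gamma> \<or> d \<notin> colors_at E c u \<and> conn (two_colored E c d \<gamma>) v u}"

lemma edge_neq: "{p, q} \<in> E \<Longrightarrow> p \<noteq> q"
  using edge_card by fastforce

lemma edge_at:
  assumes "e \<in> E" "p \<in> e"
  obtains q where "e = {p, q}"
proof -
  obtain a b where "e = {a, b}" using edge_card[OF assms(1)] by (auto simp: card_2_iff)
  with assms(2) that show ?thesis by (metis insertE insert_commute singletonD)
qed

lemma finite_heavy: "finite {w. {v, w} \<in> E \<and> 3 < degree E w}"
proof -
  have "inj (\<lambda>w. {v, w})" by (auto simp: inj_def doubleton_eq_iff)
  then have "finite ((\<lambda>w. {v, w}) -` E)" using finite_E by (rule finite_vimageI[rotated])
  then show ?thesis by (rule rev_finite_subset) auto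
qed

lemma finite_heavy_colors: "finite (heavy_colors c)"
  and card_heavy_colors: "card (heavy_colors c) \<le> 3"
  unfolding heavy_colors_def using finite_heavy heavy card_image_le le_trans by blast+

lemma finite_free: "finite (free c)"
  by (simp add: free_def)

lemma card_free: "6 \<le> card (free c)"
proof -
  \<comment> \<open>At most \<open>D - 1\<close> colors occur at \<open>v\<close>, and
    \<open>D + 5 - (D - 1) = 6\<close>.\<close>
  have "card (colors_at E c v) < D"
    using card_colors_at[OF finite_E] degree_v le_less_trans by blast
  then show ?thesis
    unfolding free_def using diff_card_le_card_Diff[OF finite_colors_at[OF finite_E], of "{..<D + 5}" c v]
    by simp
qed

lemma card_colors_at_minus:
  assumes "e \<in> E" "u \<in> e" "degree E u \<le> Suc k"
  shows "card (colors_at (E - {e}) c u) \<le> k"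
proof -
  have "{f \<in> E - {e}. u \<in> f} = {f \<in> E. u \<in> f} - {e}" by auto
  moreover have "card ({f \<in> E. u \<in> f} - {e}) = degree E u - 1"
    unfolding degree_def using assms by (subst card_Diff_singleton) auto
  ultimately have "degree (E - {e}) u \<le> k" using assms(3) by (simp add: degree_def)
  then show ?thesis using card_colors_at[of "E - {e}" c u] finite_E by simp
qed

lemma other_colors_x: "other_colors c x = colors_at E c x"
  using missing by (simp add: other_colors_def)

lemma finite_other_colors: "finite (other_colors c u)"
  using finite_E by (simp add: other_colors_def finite_colors_at)

lemma card_other_colors: "light u \<Longrightarrow> card (other_colors c u) \<le> 2"
  unfolding light_def using card_colors_at_minus[of "{v, u}" u 2 c] other_colors_x[of c]
    card_colors_at[OF finite_E, of c x] degree_x by (auto simp: other_colors_def)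

lemma light_neq_v: "light u \<Longrightarrow> u \<noteq> v"
  unfolding light_def using edge_neq v_neq_x by auto

text \<open>Delete \<open>{v, u}\<close> if present and put it back in color \<open>d\<close>. This
  fails only if \<open>d\<close> occurs on another edge at \<open>u\<close> or a two-colored path in
  \<open>d\<close> and some \<open>\<gamma>\<close> joins \<open>v\<close> to \<open>u\<close>; the
  last edge of such a path has color \<open>\<gamma>\<close>.\<close>

lemma blocked_cover:
  assumes c: "forest_coloring E c" and u: "light u" "blocked c u"
  shows "free c \<subseteq> (\<Union>\<gamma>\<in>other_colors c u. blocks c u \<gamma>)"
proof
  fix d
  assume d: "d \<in> free c"
  let ?E = "E - {{v, u}}"
  have c': "forest_coloring ?E c" by (rule forest_coloring_mono[OF c]) simp
  have "insert {v, u} E = insert {v, u} ?E" by simp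
  then have "\<not> forest_coloring (insert {v, u} ?E) (c({v, u} := d))"
    using u(2) d unfolding blocked_def by metis
  moreover have dv: "d \<notin> colors_at ?E c v" using d by (auto simp: free_def colors_at_def)
  ultimately have *: "d \<in> other_colors c u \<or> (\<exists>\<gamma>. conn (two_colored ?E c d \<gamma>) v u)"
    using forest_coloring_insert[OF c', of v u d] by (auto simp: other_colors_def)
  show "d \<in> (\<Union>\<gamma>\<in>other_colors c u. blocks c u \<gamma>)"
  proof (cases "d \<in> other_colors c u")
    case True
    then show ?thesis using d by (auto simp: blocks_def)
  next
    case False
    then obtain \<gamma> where con: "conn (two_colored ?E c d \<gamma>) v u" using * by blast
    have "\<gamma> \<in> other_colors c u"
      using walk_to_endpoint(2)[OF _ dv _ _ con] c' False light_neq_v[OF u(1)]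
      by (auto simp: other_colors_def forest_coloring_def)
    moreover have "d \<notin> colors_at E c u"
      using False d by (auto simp: other_colors_def free_def colors_at_def)
    moreover have "conn (two_colored E c d \<gamma>) v u"
      using con by (rule conn_mono) (auto simp: two_colored_def)
    ultimately show ?thesis using d by (auto simp: blocks_def)
  qed
qed

text \<open>If \<open>\<gamma>\<close> occurs at \<open>v\<close>, it does so on an edge to a light
  \<open>t\<close> other than \<open>u\<close>. Every blocking path starts with this edge and leaves
  \<open>t\<close> by \<open>d\<close>, and \<open>t\<close> has at most two other colors. If
  \<open>\<gamma>\<close> is missing at \<open>v\<close>, there is no such path, and only
  \<open>d = \<gamma>\<close> remains.\<close>

lemma card_blocks:
  assumes c: "forest_coloring E c" and u: "light u"
    and \<gamma>: "\<gamma> \<in> other_colors c u" "\<gamma> \<notin> heavy_colors c"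
  shows "card (blocks c u \<gamma>) \<le> 2"
proof -
  have pc: "proper_edge_coloring E c" using c by (simp add: forest_coloring_def)
  have uv: "u \<noteq> v" using u by (rule light_neq_v)
  show ?thesis
  proof (cases "\<gamma> \<in> colors_at E c v")
    case True
    then obtain e where e: "e \<in> E" "v \<in> e" "c e = \<gamma>" by (auto simp: colors_at_def)
    then obtain t where t: "{v, t} \<in> E" "c {v, t} = \<gamma>"
      using edge_at by metis
    then have t3: "degree E t \<le> 3" using \<gamma>(2) by (force simp: heavy_colors_def)
    have "t \<noteq> u"
    proof
      assume "t = u"
      obtain f where f: "f \<in> E" "f \<noteq> {v, u}" "u \<in> f" "c f = \<gamma>"
        using \<gamma>(1) by (auto simp: other_colors_def colors_at_def)
      then have "f \<inter> {v, u} \<noteq> {}" by auto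
      then show False using pc f t \<open>t = u\<close> unfolding proper_edge_coloring_def by metis
    qed
    have "blocks c u \<gamma> \<subseteq> colors_at (E - {{v, t}}) c t"
    proof
      fix d
      assume d: "d \<in> blocks c u \<gamma>"
      then have dv: "d \<notin> colors_at E c v" "d \<noteq> \<gamma>"
        using True by (auto simp: blocks_def free_def)
      with d have du: "d \<notin> colors_at E c u" "conn (two_colored E c d \<gamma>) v u"
        by (auto simp: blocks_def)
      obtain t' where t': "{v, t'} \<in> E" "c {v, t'} = \<gamma>" "t' = u \<or> d \<in> colors_at E c t'"
        using conn_first_edge[OF pc dv(1) du(1) uv du(2)] by metis
      then have "t' = t" using same_color_neighbor[OF pc] t by metis
      with t' \<open>t \<noteq> u\<close> have "d \<in> colors_at E c t" by simp
      then show "d \<in> colors_at (E - {{v, t}}) c t"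
        using dv t by (auto simp: colors_at_def)
    qed
    then have "card (blocks c u \<gamma>) \<le> card (colors_at (E - {{v, t}}) c t)"
      using finite_E by (intro card_mono finite_colors_at) auto
    also have "\<dots> \<le> 2" using card_colors_at_minus[of "{v, t}" t 2 c] t t3 by simp
    finally show ?thesis .
  next
    case False
    have "blocks c u \<gamma> \<subseteq> {\<gamma>}"
    proof
      fix d
      assume d: "d \<in> blocks c u \<gamma>"
      show "d \<in> {\<gamma>}"
      proof (rule ccontr)
        assume "d \<notin> {\<gamma>}"
        with d have "d \<notin> colors_at E c v" "d \<notin> colors_at E c u" "conn (two_colored E c d \<gamma>) u v"
          by (auto simp: blocks_def free_def dest: conn_sym)
        then have "\<gamma> \<in> colors_at E c v"
          using walk_to_endpoint(2)[OF pc, of d u v \<gamma>] uv by auto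
        with False show False by simp
      qed
    qed
    then have "card (blocks c u \<gamma>) \<le> card {\<gamma>}" by (rule card_mono[rotated]) simp
    then show ?thesis by simp
  qed
qed

lemma heavy_colors_at: "heavy_colors c \<subseteq> colors_at E c v"
  by (auto simp: heavy_colors_def intro: colors_atI)

text \<open>A heavy \<open>\<gamma>\<close> occurs at \<open>v\<close>, so it is not free and only
  paths can block; a path from \<open>v\<close> has just one other end.\<close>

lemma disjoint_blocks:
  assumes c: "forest_coloring E c" and u: "light u" "light u'" "u \<noteq> u'"
    and \<gamma>: "\<gamma> \<in> heavy_colors c"
  shows "blocks c u \<gamma> \<inter> blocks c u' \<gamma> = {}"
proof (rule ccontr)
  assume "blocks c u \<gamma> \<inter> blocks c u' \<gamma> \<noteq> {}"
  then obtain d where d: "d \<in> blocks c u \<gamma>" "d \<in> blocks c u' \<gamma>" by blast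
  then have "d \<notin> colors_at E c v" by (auto simp: blocks_def free_def)
  moreover have "d \<noteq> \<gamma>" using \<gamma> heavy_colors_at calculation by blast
  ultimately have "u = u'"
    using unique_other_endpoint[of E c d v u \<gamma> u'] d c light_neq_v[OF u(1)] light_neq_v[OF u(2)]
    by (auto simp: blocks_def forest_coloring_def)
  with u show False by simp
qed

lemma few_blocked:
  assumes c: "forest_coloring E c" and U: "\<And>u. u \<in> U \<Longrightarrow> light u \<and> blocked c u"
  shows "card U < 4"
proof (rule ccontr)
  assume "\<not> card U < 4"
  then show False
    by (intro four_blocked_impossible[of "free c" "heavy_colors c" U "other_colors c" "blocks c"])
      (use U blocked_cover[OF c] card_blocks[OF c] disjoint_blocks[OF c] finite_free card_free
        finite_heavy_colors card_heavy_colors finite_other_colors card_other_colors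
        in \<open>auto simp: blocks_def\<close>)
qed

text \<open>Otherwise the at most two colors at \<open>x\<close> spoil at most two free colors each,
  four out of at least six.\<close>

lemma blocked_x_heavy:
  assumes c: "forest_coloring E c" and b: "blocked c x"
  shows "colors_at E c x \<inter> heavy_colors c \<noteq> {}"
proof
  assume none: "colors_at E c x \<inter> heavy_colors c = {}"
  have lx: "light x" by (simp add: light_def)
  have "card (free c) \<le> card (\<Union>\<gamma>\<in>other_colors c x. blocks c x \<gamma>)"
    using blocked_cover[OF c lx b] finite_other_colors finite_free
    by (intro card_mono) (auto simp: blocks_def)
  also have "\<dots> \<le> (\<Sum>\<gamma>\<in>other_colors c x. card (blocks c x \<gamma>))"
    using finite_other_colors by (rule card_UN_le)
  also have "\<dots> \<le> (\<Sum>\<gamma>\<in>other_colors c x. 2)"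
    using card_blocks[OF c lx] none by (intro sum_mono) (auto simp: other_colors_x)
  also have "\<dots> \<le> 4" using card_other_colors[OF lx, of c] by simp
  finally show False using card_free[of c] by linarith
qed

text \<open>Induction on the number of heavy colors at \<open>x\<close>: replacing a heavy color at
  \<open>x\<close> by one that is not heavy is progress. The given coloring may change on the way,
  hence the existential \<open>c'\<close>.\<close>

lemma extend:
  assumes "forest_coloring E c" "c ` E \<subseteq> {..<D + 5}"
  shows "\<exists>c'. forest_coloring (insert {v, x} E) c' \<and> c' ` insert {v, x} E \<subseteq> {..<D + 5}"
  using assms
proof (induction "card (colors_at E c x \<inter> heavy_colors c)" arbitrary: c rule: less_induct)
  case less
  show ?case
  proof (rule ccontr)
    assume no: "\<not> ?thesis"
    have no_smaller: "\<not> forest_coloring E c'"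
      if "c' ` E \<subseteq> {..<D + 5}"
        "card (colors_at E c' x \<inter> heavy_colors c') < card (colors_at E c x \<inter> heavy_colors c)" for c'
      using less.hyps[of c'] no that by blast
    have no_ext: "\<not> forest_coloring (insert {v, x} E) (c'({v, x} := d))"
      if "c' ` E \<subseteq> {..<D + 5}" "d < D + 5" for c' d
    proof -
      have "(c'({v, x} := d)) ` insert {v, x} E \<subseteq> {..<D + 5}" using that by auto
      then show ?thesis using no by blast
    qed
    have bx: "blocked c x" using no_ext[OF less.prems(2)] by (auto simp: blocked_def free_def)
    have lx: "light x" by (simp add: light_def)
    obtain e where e: "e \<in> E" "x \<in> e" "c e \<in> heavy_colors c"
      using blocked_x_heavy[OF less.prems(1) bx] by (auto simp: colors_at_def)
    then obtain y where y: "e = {x, y}"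
      using edge_at by metis
    have xy: "{x, y} \<in> E" "c {x, y} \<in> heavy_colors c" "x \<noteq> y" "y \<noteq> v"
      using e y edge_neq missing by (auto simp: insert_commute)
    let ?F = "E - {{x, y}}"
    \<comment> \<open>At most one edge besides \<open>{x, y}\<close> is left at \<open>x\<close>;
      this determines the second color of the two-colored paths below.\<close>
    have one: "card (colors_at ?F c' x) \<le> 1" for c'
      using card_colors_at_minus[OF xy(1), of x 1 c'] degree_x by simp
    have same: "\<gamma> = \<delta>" if "\<gamma> \<in> colors_at ?F c' x" "\<delta> \<in> colors_at ?F c' x" for \<gamma> \<delta> c'
      using one[of c'] that finite_E finite_colors_at[of ?F c' x] card_le_Suc0_iff_eq by auto
    \<comment> \<open>Stated for a coloring \<open>c'\<close> because it is needed again after an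
      edge \<open>{v, u}\<close> has been recolored; the agreement with \<open>c\<close> preserves
      the induction measure.\<close>
    have key: "\<theta> \<in> colors_at E c' v \<and> (\<exists>\<gamma>\<in>colors_at ?F c' x. \<gamma> \<in> colors_at ?F c' y)"
      if c': "forest_coloring E c'" "c' ` E \<subseteq> {..<D + 5}"
        and agree: "heavy_colors c' = heavy_colors c" "colors_at E c' x = colors_at E c x"
          "c' {x, y} = c {x, y}"
        and \<theta>: "\<theta> < D + 5" "\<theta> \<notin> heavy_colors c" "\<theta> \<notin> colors_at ?F c' y" "\<theta> \<notin> colors_at E c x"
      for c' \<theta>
    proof -
      have pc: "proper_edge_coloring E c'" using c' by (simp add: forest_coloring_def)
      let ?c = "c'({x, y} := \<theta>)"
      have "\<not> forest_coloring E ?c"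
      proof (rule no_smaller)
        show "?c ` E \<subseteq> {..<D + 5}" using c'(2) \<theta>(1) by auto
        have "heavy_colors ?c = heavy_colors c'"
          unfolding heavy_colors_def using v_neq_x xy(4) by (intro image_cong) (auto simp: doubleton_eq_iff)
        moreover have "colors_at E ?c x \<subseteq> insert \<theta> (colors_at E c' x - {c' {x, y}})"
        proof
          fix \<alpha>
          assume "\<alpha> \<in> colors_at E ?c x"
          then obtain f where f: "f \<in> E" "x \<in> f" "\<alpha> = ?c f" unfolding colors_at_def by blast
          show "\<alpha> \<in> insert \<theta> (colors_at E c' x - {c' {x, y}})"
          proof (cases "f = {x, y}")
            case False
            moreover have "f \<inter> {x, y} \<noteq> {}" using f by auto
            ultimately have "c' f \<noteq> c' {x, y}"
              using pc f xy(1) unfolding proper_edge_coloring_def by metis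
            then show ?thesis using f False by (auto intro: colors_atI)
          qed (use f in simp)
        qed
        ultimately have "colors_at E ?c x \<inter> heavy_colors ?c
          \<subseteq> (colors_at E c x \<inter> heavy_colors c) - {c {x, y}}"
          using \<theta>(2) agree by auto
        moreover have "c {x, y} \<in> colors_at E c x \<inter> heavy_colors c"
          using xy by (auto intro: colors_atI)
        ultimately have "colors_at E ?c x \<inter> heavy_colors ?c \<subset> colors_at E c x \<inter> heavy_colors c"
          by blast
        then show "card (colors_at E ?c x \<inter> heavy_colors ?c) < card (colors_at E c x \<inter> heavy_colors c)"
          using finite_heavy_colors by (intro psubset_card_mono) auto
      qed
      moreover have "insert {x, y} ?F = E" using xy(1) by auto
      moreover have cF: "forest_coloring ?F c'" using c'(1) by (rule forest_coloring_mono) simp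
      moreover have xF: "\<theta> \<notin> colors_at ?F c' x"
        using \<theta>(4) agree(2) by (auto simp: colors_at_def)
      ultimately obtain \<gamma> where con: "conn (two_colored ?F c' \<theta> \<gamma>) x y"
        using forest_coloring_insert[OF cF, of x y \<theta>] \<theta>(3) by auto
      have pF: "proper_edge_coloring ?F c'" using cF by (simp add: forest_coloring_def)
      have \<gamma>: "\<gamma> \<in> colors_at ?F c' y" "\<gamma> \<in> colors_at ?F c' x"
        using walk_to_endpoint(2)[OF pF xF \<theta>(3) _ con]
          walk_to_endpoint(2)[OF pF \<theta>(3) xF _ conn_sym[OF con]] xy(3) by auto
      \<comment> \<open>Otherwise try \<open>\<theta>\<close> on \<open>{v, x}\<close>. A path
        preventing this cannot leave \<open>x\<close> along \<open>{x, y}\<close>, as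
        \<open>\<theta>\<close> is missing at \<open>y\<close>, so its second color is
        \<open>\<gamma>\<close>. Then one path from \<open>x\<close> would end both at
        \<open>v\<close> and at \<open>y\<close>.\<close>
      have "\<theta> \<in> colors_at E c' v"
      proof (rule ccontr)
        assume v\<theta>: "\<theta> \<notin> colors_at E c' v"
        have x\<theta>: "\<theta> \<notin> colors_at E c' x" using \<theta>(4) agree(2) by simp
        have y\<theta>: "\<theta> \<notin> colors_at E c' y"
          using \<theta>(2,3) agree(3) xy(2) by (auto simp: colors_at_def)
        have "\<not> conn (two_colored E c' \<theta> \<delta>) v x" for \<delta>
        proof
          assume "conn (two_colored E c' \<theta> \<delta>) v x"
          then have xv: "conn (two_colored E c' \<theta> \<delta>) x v" by (rule conn_sym)
          obtain t where t: "{x, t} \<in> E" "c' {x, t} = \<delta>" "t = v \<or> \<theta> \<in> colors_at E c' t"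
            using conn_first_edge[OF pc x\<theta> v\<theta> v_neq_x xv] by metis
          then have "t \<noteq> y" using y\<theta> xy(4) by auto
          then have "{x, t} \<in> ?F" using t(1) by (auto simp: doubleton_eq_iff)
          then have "\<delta> \<in> colors_at ?F c' x" using t(2) by (auto simp: colors_at_def)
          then have "\<delta> = \<gamma>" using same \<gamma>(2) by blast
          moreover have "conn (two_colored E c' \<theta> \<gamma>) x y"
            using con by (rule conn_mono) (auto simp: two_colored_def)
          ultimately have "v = y"
            using unique_other_endpoint[OF pc x\<theta> v\<theta> v_neq_x xv y\<theta>] xy(3) by auto
          with xy(4) show False by simp
        qed
        then show False
          using forest_coloring_insert[OF c'(1) missing v\<theta> x\<theta>] no_ext[OF c'(2) \<theta>(1)] by blast
      qed
      with \<gamma> show ?thesis by blast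
    qed
    define A where "A = {..<D + 5} - colors_at ?F c y - heavy_colors c - colors_at E c x"
    have keyA: "\<theta> \<in> colors_at E c v \<and> (\<exists>\<gamma>\<in>colors_at ?F c x. \<gamma> \<in> colors_at ?F c y)"
      if "\<theta> \<in> A" for \<theta>
      using key[of c \<theta>] less.prems that by (auto simp: A_def)
    have "0 < D" using degree_v by simp
    then have "card (colors_at ?F c y) \<le> D - 1"
      using card_colors_at_minus[OF xy(1), of y "D - 1" c] degree_le[of y] by simp
    then have six: "6 \<le> card ({..<D + 5} - colors_at ?F c y)"
      using diff_card_le_card_Diff[of "colors_at ?F c y" "{..<D + 5}"] finite_E \<open>0 < D\<close>
      by (simp add: finite_colors_at)
    have xF: "colors_at E c x \<subseteq> insert (c {x, y}) (colors_at ?F c x)"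
      by (auto simp: colors_at_def)
    \<comment> \<open>A first, weaker count: from at least six colors not on the other edges at
      \<open>y\<close>, remove at most three heavy ones and one more at \<open>x\<close>;
      \<open>c {x, y}\<close> is itself heavy. At least two are left.\<close>
    have "{..<D + 5} - colors_at ?F c y - (heavy_colors c \<union> colors_at ?F c x) \<subseteq> A"
      using xF xy(2) by (auto simp: A_def)
    moreover have "card (heavy_colors c \<union> colors_at ?F c x) \<le> 4"
      using card_Un_le[of "heavy_colors c" "colors_at ?F c x"] card_heavy_colors[of c] one[of c]
      by linarith
    then have "2 \<le> card ({..<D + 5} - colors_at ?F c y - (heavy_colors c \<union> colors_at ?F c x))"
      using diff_card_le_card_Diff[of "heavy_colors c \<union> colors_at ?F c x" "{..<D + 5} - colors_at ?F c y"]
        six finite_E finite_heavy_colors[of c] by (simp add: finite_colors_at)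
    ultimately have "A \<noteq> {}"
      by (metis card.empty not_numeral_le_zero subset_empty)
    then obtain \<gamma> where \<gamma>: "\<gamma> \<in> colors_at ?F c x" "\<gamma> \<in> colors_at ?F c y" using keyA by blast
    \<comment> \<open>Now the other color at \<open>x\<close> is known to occur at \<open>y\<close>
      as well, so it need not be removed separately and the count rises to three.\<close>
    then have "colors_at ?F c x \<subseteq> colors_at ?F c y" using same by blast
    then have "{..<D + 5} - colors_at ?F c y - heavy_colors c \<subseteq> A"
      using xF xy(2) by (auto simp: A_def)
    moreover have "3 \<le> card ({..<D + 5} - colors_at ?F c y - heavy_colors c)"
      using diff_card_le_card_Diff[OF finite_heavy_colors[of c], of "{..<D + 5} - colors_at ?F c y"]
        six card_heavy_colors[of c] by simp
    moreover have finA: "finite A" by (simp add: A_def)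
    ultimately have A3: "3 \<le> card A" using card_mono le_trans by metis
    have "\<exists>u. {v, u} \<in> E \<and> c {v, u} = \<theta>" if \<theta>: "\<theta> \<in> A" for \<theta>
    proof -
      obtain f where f: "f \<in> E" "v \<in> f" "c f = \<theta>"
        using keyA[OF \<theta>] by (auto simp: colors_at_def)
      then obtain u where "f = {v, u}"
        using edge_at by metis
      with f show ?thesis by blast
    qed
    then obtain g where g: "\<And>\<theta>. \<theta> \<in> A \<Longrightarrow> {v, g \<theta>} \<in> E \<and> c {v, g \<theta>} = \<theta>" by metis
    have pc: "proper_edge_coloring E c" using less.prems by (simp add: forest_coloring_def)
    have gA: "light (g \<theta>) \<and> blocked c (g \<theta>)" if \<theta>: "\<theta> \<in> A" for \<theta>
    proof
      let ?u = "g \<theta>"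
      have u: "{v, ?u} \<in> E" "c {v, ?u} = \<theta>" using g[OF \<theta>] by auto
      have "\<theta> \<notin> heavy_colors c" using \<theta> by (simp add: A_def)
      with u have u3: "degree E ?u \<le> 3" by (force simp: heavy_colors_def)
      with u show "light ?u" by (simp add: light_def)
      have ux: "x \<notin> {v, ?u}" using u missing v_neq_x by auto
      have uy: "y \<notin> {v, ?u}"
      proof -
        have "?u \<noteq> y"
        proof
          assume "?u = y"
          then have "{v, y} \<in> ?F" "c {v, y} = \<theta>" using u v_neq_x by (auto simp: doubleton_eq_iff)
          then have "\<theta> \<in> colors_at ?F c y" by (auto simp: colors_at_def)
          with \<theta> show False by (simp add: A_def)
        qed
        with xy(4) show ?thesis by auto
      qed
      \<comment> \<open>Recoloring \<open>{v, ?u}\<close> with \<open>d\<close> would remove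
        \<open>\<theta>\<close> from \<open>v\<close>, whereas \<open>key\<close> for the new
        coloring still requires it there. As \<open>?u\<close> is light and differs from
        \<open>x\<close> and \<open>y\<close>, the assumptions of \<open>key\<close> survive the
        change.\<close>
      show "blocked c ?u"
        unfolding blocked_def
      proof (intro ballI notI)
        fix d
        assume d: "d \<in> free c" and good: "forest_coloring (insert {v, ?u} E) (c({v, ?u} := d))"
        let ?c = "c({v, ?u} := d)"
        have unchanged: "colors_at G ?c w = colors_at G c w" if "w \<notin> {v, ?u}" for w G
          unfolding colors_at_def using that by (intro image_cong) auto
        have "\<theta> \<in> colors_at E ?c v"
        proof (rule conjunct1[OF key])
          show "forest_coloring E ?c" using good u(1) by (simp add: insert_absorb)
          show "?c ` E \<subseteq> {..<D + 5}" using less.prems(2) d by (auto simp: free_def)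
          show "heavy_colors ?c = heavy_colors c"
            unfolding heavy_colors_def using u3 by (intro image_cong) (auto simp: doubleton_eq_iff)
          show "colors_at E ?c x = colors_at E c x" using unchanged[OF ux] .
          show "?c {x, y} = c {x, y}" using ux by auto
          show "\<theta> \<notin> colors_at ?F ?c y" using unchanged[OF uy] \<theta> by (simp add: A_def)
        qed (use \<theta> in \<open>auto simp: A_def\<close>)
        then obtain f where f: "f \<in> E" "v \<in> f" "\<theta> = ?c f"
          unfolding colors_at_def by blast
        have "\<theta> \<in> colors_at E c v" using keyA[OF \<theta>] by simp
        with d have "d \<noteq> \<theta>" by (auto simp: free_def)
        with f(3) have "f \<noteq> {v, ?u}" by auto
        moreover with f(3) have "c f = \<theta>" by simp
        moreover have "f \<inter> {v, ?u} \<noteq> {}" using f by auto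
        ultimately show False using pc f(1) u unfolding proper_edge_coloring_def by metis
      qed
    qed
    have "inj_on g A" using g by (metis inj_onI)
    then have "card (g ` A) = card A" by (rule card_image)
    \<comment> \<open>The vertex \<open>x\<close> itself is the fourth blocked vertex.\<close>
    moreover have "x \<notin> g ` A" using g missing by auto
    ultimately have "4 \<le> card (insert x (g ` A))" using A3 finA by simp
    moreover have "card (insert x (g ` A)) < 4"
      using gA lx bx by (intro few_blocked[OF less.prems(1)]) auto
    ultimately show False by simp
  qed
qed

end

section \<open>Choice of the deleted edge and induction on the number of edges\<close>

text \<open>Degeneracy of the subgraph induced by the heavy vertices yields a heavy \<open>v\<close>
  with at most three heavy neighbors. Since \<open>v\<close> has at least four edges, one of them
  leads to a light vertex. If no vertex is heavy, any edge will do.\<close>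

lemma exists_light_edge:
  assumes G: "simple_graph V E" and deg: "degenerate 3 V E" and "E \<noteq> {}"
  obtains v x where "{v, x} \<in> E" "v \<noteq> x" "degree E x \<le> 3"
    "card {w. {v, w} \<in> E \<and> 3 < degree E w} \<le> 3"
proof -
  have "finite V" and E: "\<And>e. e \<in> E \<Longrightarrow> e \<subseteq> V \<and> card e = 2"
    using G by (auto simp: simple_graph_def)
  define H where "H = {w \<in> V. 3 < degree E w}"
  define F where "F = {e \<in> E. e \<subseteq> H}"
  have heavy_in_H: "w \<in> H" if "{v, w} \<in> E" "3 < degree E w" for v w
    using E[OF that(1)] that(2) by (simp add: H_def)
  show ?thesis
  proof (cases "H = {}")
    case True
    obtain e where "e \<in> E" using assms(3) by blast
    then obtain v x where e: "{v, x} \<in> E" "v \<noteq> x" using E[of e] by (auto simp: card_2_iff)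
    then have "x \<in> V" using E by blast
    with True have "degree E x \<le> 3" by (auto simp: H_def)
    moreover have "card {w. {v, w} \<in> E \<and> 3 < degree E w} = 0"
      using heavy_in_H True by (metis (no_types, lifting) Collect_empty_eq card.empty empty_iff)
    ultimately show ?thesis using that[OF e] by linarith
  next
    case False
    have "finite E" using E \<open>finite V\<close> by (auto intro: finite_subset[of E "Pow V"])
    have "subgraph H F V E"
      using E \<open>finite V\<close> by (auto simp: subgraph_def simple_graph_def H_def F_def)
    then obtain v where v: "v \<in> H" "degree F v \<le> 3"
      using deg False unfolding degenerate_def by blast
    have "inj_on (\<lambda>w. {v, w}) {w. {v, w} \<in> E \<and> 3 < degree E w}"
      by (auto simp: inj_on_def doubleton_eq_iff)
    moreover have "(\<lambda>w. {v, w}) ` {w. {v, w} \<in> E \<and> 3 < degree E w} \<subseteq> {e \<in> F. v \<in> e}"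
      using heavy_in_H v(1) by (auto simp: F_def)
    moreover have "finite {e \<in> F. v \<in> e}" using \<open>finite E\<close> by (simp add: F_def)
    ultimately have "card {w. {v, w} \<in> E \<and> 3 < degree E w} \<le> card {e \<in> F. v \<in> e}"
      by (rule card_inj_on_le)
    then have few: "card {w. {v, w} \<in> E \<and> 3 < degree E w} \<le> 3"
      using v(2) by (simp add: degree_def)
    have "\<not> {e \<in> E. v \<in> e} \<subseteq> {e \<in> F. v \<in> e}"
    proof
      assume "{e \<in> E. v \<in> e} \<subseteq> {e \<in> F. v \<in> e}"
      then have "degree E v \<le> degree F v"
        unfolding degree_def using \<open>finite {e \<in> F. v \<in> e}\<close> by (rule card_mono[rotated])
      with v show False by (simp add: H_def)
    qed
    then obtain e where e: "e \<in> E" "v \<in> e" "\<not> e \<subseteq> H" by (auto simp: F_def)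
    then obtain x where x: "x \<in> e" "x \<notin> H" by blast
    then have neq: "v \<noteq> x" using v by blast
    have "e = {v, x}"
      using E[OF e(1)] e(2) x(1) neq by (auto simp: card_2_iff)
    then have "{v, x} \<in> E" using e by simp
    moreover have "degree E x \<le> 3"
      using E[OF e(1)] x by (auto simp: H_def)
    ultimately show ?thesis using that neq few by blast
  qed
qed

text \<open>The fixed bound \<open>D\<close> stands in for the maximum degree, which may drop when
  an edge is deleted, while the number of colors has to stay the same.\<close>

lemma exists_coloring:
  assumes "simple_graph V E" "degenerate 3 V E" "\<And>u. degree E u \<le> D"
  shows "\<exists>c. forest_coloring E c \<and> c ` E \<subseteq> {..<D + 5}"
  using assms
proof (induction "card E" arbitrary: E rule: less_induct)
  case less
  have finE: "finite E" and E: "\<And>e. e \<in> E \<Longrightarrow> e \<subseteq> V \<and> card e = 2"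
    using less.prems(1) by (auto simp: simple_graph_def intro: finite_subset[of E "Pow V"])
  show ?case
  proof (cases "E = {}")
    case True
    then show ?thesis
      by (simp add: forest_coloring_def proper_edge_coloring_def forest_def two_colored_def)
  next
    case False
    obtain v x where vx: "{v, x} \<in> E" "v \<noteq> x" "degree E x \<le> 3"
      "card {w. {v, w} \<in> E \<and> 3 < degree E w} \<le> 3"
      by (rule exists_light_edge[OF less.prems(1,2) False])
    let ?F = "E - {{v, x}}"
    have deg_le: "degree ?F u \<le> degree E u" for u
      unfolding degree_def using finE by (intro card_mono) auto
    have deg_less: "degree ?F u < degree E u" if "u \<in> {v, x}" for u
      unfolding degree_def using finE vx(1) that by (intro psubset_card_mono) auto
    have inj: "inj (\<lambda>w. {v, w})" by (auto simp: inj_def doubleton_eq_iff)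
    have "finite {w. {v, w} \<in> E \<and> 3 < degree E w}"
      using finite_vimageI[OF finE inj] by (rule rev_finite_subset) auto
    \<comment> \<open>Degrees only fall, so the deletion creates no heavy neighbor.\<close>
    moreover have "{w. {v, w} \<in> ?F \<and> 3 < degree ?F w} \<subseteq> {w. {v, w} \<in> E \<and> 3 < degree E w}"
      by (auto intro: less_le_trans[OF _ deg_le])
    ultimately have "card {w. {v, w} \<in> ?F \<and> 3 < degree ?F w} \<le> 3"
      using vx(4) by (meson card_mono le_trans)
    moreover have deg_F: "degree ?F u \<le> D" for u
      using deg_le less.prems(3) le_trans by blast
    moreover have "degree ?F v < D"
      using deg_less[of v] less.prems(3)[of v] by simp
    moreover have "degree ?F x \<le> 2" using deg_less[of x] vx(3) by simp
    ultimately interpret missing_edge ?F v x D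
      using finE E vx(2) by unfold_locales auto
    have "card ?F < card E" using vx(1) finE by (intro psubset_card_mono) auto
    moreover have "simple_graph V ?F" using less.prems(1) by (auto simp: simple_graph_def)
    moreover have "degenerate 3 V ?F"
      using less.prems(2) unfolding degenerate_def subgraph_def by blast
    ultimately obtain c where c: "forest_coloring ?F c" "c ` ?F \<subseteq> {..<D + 5}"
      using less.hyps[of ?F] deg_F by blast
    have "insert {v, x} ?F = E" using vx(1) by auto
    then show ?thesis using extend[OF c] by (simp only:)
  qed
qed

lemma degree_le_max_degree:
  assumes "simple_graph V E"
  shows "degree E u \<le> max_degree V E"
proof (cases "u \<in> V")
  case True
  then show ?thesis
    using assms unfolding max_degree_def simple_graph_def by (intro Max_ge) auto
next
  case False
  then have "{e \<in> E. u \<in> e} = {}" using assms by (auto simp: simple_graph_def)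
  then have "degree E u = 0" unfolding degree_def by (simp only: card.empty)
  then show ?thesis by simp
qed

theorem theorem2:
  fixes V :: "'a set" and E :: "'a set set"
  assumes "simple_graph V E"
    and "degenerate 3 V E"
  shows "acyclic_chromatic_index E \<le> max_degree V E + 5"
proof -
  obtain c where c: "forest_coloring E c" "c ` E \<subseteq> {..<max_degree V E + 5}"
    using exists_coloring[OF assms degree_le_max_degree[OF assms(1)]] by blast
  have "acyclic_chromatic_index E \<le> card (c ` E)"
    unfolding acyclic_chromatic_index_def using forest_coloring_acyclic[OF c(1)]
    by (intro Least_le) blast
  also have "\<dots> \<le> card {..<max_degree V E + 5}"
    using c(2) by (intro card_mono) auto
  finally show ?thesis by simp
qed

end
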